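(* Let $(z_k)_{k\in\mathbb{N}}$ and $(z'_k)_{k\in\mathbb{N}}$ be two sequences, each consisting of pairwise distinct complex numbers, with $|z_k|\to\infty$ and $|z'_k|\to\infty$. Let $f$ and $g$ be Weierstrass maps whose simple zeros are the points $z_1,z_2,\ldots$ and $z'_1,z'_2,\ldots$, respectively, and consider the infinite hyperelliptic curves $S(f)=\{(z,w)\in\mathbb{C}^2: w^2=f(z)\}$ and $S(g)=\{(z,w)\in\mathbb{C}^2: w^2=g(z)\}$ with their tame translation structures. Then there exists a fiber-preserving to descend isomorphism $\tilde T:S(f)\to S(g)$ if and only if there exists an isomorphism $T:\mathbb{C}\to\mathbb{C}$ (of translation surfaces) sending the zeros of $f$ onto the zeros of $g$.
   Context: Weierstrass map: for a sequence $(z_k)_{k\in\mathbb{N}}$ of distinct complex numbers with $|z_k|\to\infty$, a function $f(z)=h(z)z^{m}\prod_{k\ge 1,\,z_k\ne 0}\left(1-\frac{z}{z_k}\right)E_k(z)$, where $h$ is a zero-free entire function, $m=1$ if some $z_k=0$ and $m=0$ otherwise, and $E_k(z)=\exp\left[\sum_{s=1}^{d(k)}\frac1s\left(\frac{z}{z_k}\right)^s\right]$ with suitably large non-negative integers $d(k)$ (so that the product converges). Its zeros are simple and are exactly the points $z_k$. Translation structure on $S(f)$: let $p_{\mathbf z}:S(f)\to\mathbb{C}$, $(z,w)\mapsto z$. The restriction $p_{\mathbf z}: S(f)\setminus\{(z_k,0):k\in\mathbb{N}\}\to\mathbb{C}\setminus\{z_k:k\in\mathbb{N}\}$ is an unramified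 covering, by which the standard translation structure of $\mathbb{C}\setminus\{z_k\}$ (an atlas whose transition maps are translations) is pulled back. The set of singular points (cone points) is ${\rm Sing}(S(f))=\{(z_k,0):k\in\mathbb{N}\}$. The same construction is used for $S(g)$. The plane $\mathbb{C}$ carries its standard translation structure, with no singular points. Isomorphism: for tame translation surfaces $S_1,S_2$ with (maximal) translation atlases $\mathcal A=\{(U_i,\phi_i)\}_{i\in\mathcal I}$ and $\mathcal B$, respectively, a homeomorphism $T:S_1\to S_2$ is an isomorphism if $T({\rm Sing}(S_1))={\rm Sing}(S_2)$ and $\mathcal B=\{(T(U_i),\phi_i\circ T^{-1})\}_{i\in\mathcal I}$. (In particular, the isomorphisms of $\mathbb{C}$ onto itself are exactly the translations $z\mapsto z+b$, $b\in\mathbb{C}$.) An isomorphism $T:S(f)\to S(g)$ is called fiber-preserving to descend if whenever $(u_1,v_1)$ and $(u_2,v_2)$ lie in the same fiber $p_{\mathbf z}^{-1}(z)$, for any $z\in\mathbb{C}\setminus\{z_k:k\in\mathbb{N}\}$, one has $p_{\mathbf z}\circ T(u_1,v_1)=p_{\mathbf z}\circ T(u_2,v_2)$, where $p_{\mathbf z}$ denotes the projection onto the first coordinate (on either curve). *)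

theory Defs
  imports "HOL-Complex_Analysis.Complex_Analysis"
begin

section \<open>Weierstrass maps\<close>

text \<open>
  The factor \<open>(1 - x / z\<^sub>k) E\<^sub>k(x)\<close>, where \<open>d\<close> is the degree of the polynomial in the exponent.
  The index of a vanishing term of the sequence is skipped by means of the factor \<open>1\<close>.
\<close>
definition weierstrass_term :: "(nat \<Rightarrow> complex) \<Rightarrow> (nat \<Rightarrow> nat) \<Rightarrow> nat \<Rightarrow> complex \<Rightarrow> complex" where
  "weierstrass_term z d k x = (if z k = 0 then 1 else weierstrass_factor (d k) (x / z k))"

text \<open>
  The degrees \<open>d\<close> are required to make the product converge in the sense in which infinite
  products of holomorphic functions converge: at every point (to a nonzero value, up to finitely
  many vanishing factors), and with partial products converging uniformly on compact sets.
\<close>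
definition weierstrass_map :: "(nat \<Rightarrow> complex) \<Rightarrow> (complex \<Rightarrow> complex) \<Rightarrow> bool" where
  "weierstrass_map z f \<longleftrightarrow>
     (\<exists>h d. h holomorphic_on UNIV \<and> (\<forall>x. h x \<noteq> 0) \<and>
        (\<forall>x. convergent_prod (\<lambda>k. weierstrass_term z d k x)) \<and>
        (\<forall>K. compact K \<longrightarrow> uniformly_convergent_on K (\<lambda>n x. \<Prod>k<n. weierstrass_term z d k x)) \<and>
        (\<forall>x. f x = h x * x ^ (if 0 \<in> range z then 1 else 0) * (\<Prod>k. weierstrass_term z d k x)))"

lemma weierstrass_map_zeros:
  assumes "weierstrass_map z f"
  shows "{x. f x = 0} = range z"
proof -
  obtain h d where h: "\<And>x. h x \<noteq> 0"
    and c: "\<And>x. convergent_prod (\<lambda>k. weierstrass_term z d k x)"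
    and f: "\<And>x. f x = h x * x ^ (if 0 \<in> range z then 1 else 0) * (\<Prod>k. weierstrass_term z d k x)"
    using assms unfolding weierstrass_map_def by blast
  have P: "(\<Prod>k. weierstrass_term z d k x) = 0 \<longleftrightarrow> (\<exists>k. z k \<noteq> 0 \<and> x = z k)" for x
  proof -
    have "(\<Prod>k. weierstrass_term z d k x) = 0 \<longleftrightarrow> 0 \<in> range (\<lambda>k. weierstrass_term z d k x)"
      using has_prod_eq_0_iff[OF convergent_prod_has_prod[OF c[of x]]] .
    also have "\<dots> \<longleftrightarrow> (\<exists>k. z k \<noteq> 0 \<and> x = z k)"
      by (auto simp: weierstrass_term_def image_iff divide_simps split: if_splits)
    finally show ?thesis .
  qed
  have "f x = 0 \<longleftrightarrow> x \<in> range z" for x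
    by (cases "x = 0") (auto simp: f h P image_iff)
  thus ?thesis by blast
qed


section \<open>Translation structures\<close>

text \<open>
  Charts are pairs of a domain and a coordinate function. Coordinate functions are extensional
  (\<^term>\<open>undefined\<close> outside the domain), so that charts which agree as partial functions are equal
  and atlases can be compared as sets.
\<close>
type_synonym 'a chart = "'a set \<times> ('a \<Rightarrow> complex)"

definition is_chart :: "'a::topological_space set \<Rightarrow> 'a chart \<Rightarrow> bool" where
  "is_chart X c \<longleftrightarrow> (case c of (U, \<phi>) \<Rightarrow>
     openin (top_of_set X) U \<and> \<phi> \<in> extensional U \<and> open (\<phi> ` U) \<and>
     (\<exists>\<psi>. homeomorphism U (\<phi> ` U) \<phi> \<psi>))"

text \<open>
  The overlap of two charts need not be connected; as usual, a transition map has to be a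
  translation on each connected component of its domain, the vector depending on the component.
\<close>
definition translation_transition :: "'a chart \<Rightarrow> 'a chart \<Rightarrow> bool" where
  "translation_transition c d \<longleftrightarrow> (case (c, d) of ((U, \<phi>), (V, \<psi>)) \<Rightarrow>
     \<forall>C \<in> components (\<phi> ` (U \<inter> V)). \<exists>b. \<forall>x \<in> C. \<psi> (inv_into U \<phi> x) = x + b)"

text \<open>The maximal translation atlas on \<open>X\<close> determined by a translation atlas \<open>A\<close>.\<close>
definition maximal_atlas :: "'a::topological_space set \<Rightarrow> 'a chart set \<Rightarrow> 'a chart set" where
  "maximal_atlas X A =
     {c. is_chart X c \<and> (\<forall>a \<in> A. translation_transition c a \<and> translation_transition a c)}"

definition standard_atlas :: "complex set \<Rightarrow> complex chart set" where
  "standard_atlas \<Omega> = maximal_atlas \<Omega> {(\<Omega>, restrict id \<Omega>)}"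

text \<open>The pullback of an atlas \<open>A\<close> along a local homeomorphism \<open>p\<close> defined on \<open>X\<close>.\<close>
definition pullback_atlas ::
    "'a::topological_space set \<Rightarrow> ('a \<Rightarrow> complex) \<Rightarrow> complex chart set \<Rightarrow> 'a chart set" where
  "pullback_atlas X p A = maximal_atlas X
     {(U, restrict (\<phi> \<circ> p) U) | U V \<phi>.
        (V, \<phi>) \<in> A \<and> openin (top_of_set X) U \<and> (\<exists>q. homeomorphism U V p q)}"

text \<open>
  Points carry the subspace topology of the ambient type; the charts of the atlas cover the
  complement of the singular points.
\<close>
record 'a translation_surface =
  points :: "'a set"
  Sing :: "'a set"
  atlas :: "'a chart set"

definition translation_isomorphism ::
    "'a::topological_space translation_surface \<Rightarrow> 'b::topological_space translation_surface
      \<Rightarrow> ('a \<Rightarrow> 'b) \<Rightarrow> bool" where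
  "translation_isomorphism S1 S2 T \<longleftrightarrow>
     (\<exists>T'. homeomorphism (points S1) (points S2) T T') \<and>
     T ` Sing S1 = Sing S2 \<and>
     atlas S2 = {(T ` U, restrict (\<phi> \<circ> inv_into (points S1) T) (T ` U)) | U \<phi>. (U, \<phi>) \<in> atlas S1}"

definition plane :: "complex translation_surface" where
  "plane = \<lparr>points = UNIV, Sing = {}, atlas = standard_atlas UNIV\<rparr>"

lemma plane_chart_iff:
  "(U, \<phi>) \<in> atlas plane \<longleftrightarrow> is_chart UNIV (U, \<phi>) \<and>
     (\<forall>C \<in> components (\<phi> ` U). \<exists>b. \<forall>x \<in> C. inv_into U \<phi> x = x + b) \<and>
     (\<forall>C \<in> components U. \<exists>b. \<forall>x \<in> C. \<phi> x = x + b)"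
  by (simp add: plane_def standard_atlas_def maximal_atlas_def translation_transition_def restrict_UNIV)

lemma shift_chart:
  assumes "(U, \<phi>) \<in> atlas plane"
  shows "((\<lambda>x. x + b) ` U, restrict (\<phi> \<circ> inv_into UNIV (\<lambda>x. x + b)) ((\<lambda>x. x + b) ` U)) \<in> atlas plane"
proof -
  let ?t = "\<lambda>x::complex. x + b"
  have inv: "inv_into UNIV ?t = (\<lambda>x. x - b)"
    by (intro inv_unique_comp) auto
  let ?V = "?t ` U" and ?p = "restrict (\<phi> \<circ> (\<lambda>x. x - b)) (?t ` U)"
  have im: "?p ` ?V = \<phi> ` U" by (auto simp: image_iff)
  from assms obtain \<psi> where 1: "open U" "open (\<phi> ` U)" "homeomorphism U (\<phi> ` U) \<phi> \<psi>"
    and 2: "\<And>C. C \<in> components (\<phi> ` U) \<Longrightarrow> \<exists>b. \<forall>x \<in> C. inv_into U \<phi> x = x + b"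
    and 3: "\<And>C. C \<in> components U \<Longrightarrow> \<exists>b. \<forall>x \<in> C. \<phi> x = x + b"
    unfolding plane_chart_iff is_chart_def by auto
  have inj: "inj_on \<phi> U" using 1(3) unfolding homeomorphism_def by (metis inj_on_inverseI)
  have h1: "homeomorphism ?V U (\<lambda>x. x - b) ?t"
    by (auto simp: homeomorphism_def image_image intro!: continuous_intros)
  have h2: "homeomorphism ?V (\<phi> ` U) ?p (?t \<circ> \<psi>)"
    by (rule homeomorphism_cong[OF homeomorphism_compose[OF h1 1(3)]]) auto
  have "open ?V" using open_translation[OF 1(1), of b] by (simp add: add.commute)
  hence ch: "is_chart UNIV (?V, ?p)"
    unfolding is_chart_def prod.case im using h2 1(2) by auto
  have injp: "inj_on ?p ?V" using h2 unfolding homeomorphism_def by (metis inj_on_inverseI)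
  have ii: "inv_into ?V ?p y = inv_into U \<phi> y + b" if "y \<in> \<phi> ` U" for y
  proof (rule inv_into_f_eq[OF injp])
    show "inv_into U \<phi> y + b \<in> ?V" using that by (auto intro: inv_into_into)
    thus "?p (inv_into U \<phi> y + b) = y" using that by (simp add: f_inv_into_f)
  qed
  have A: "\<exists>c. \<forall>x \<in> C. inv_into ?V ?p x = x + c" if C: "C \<in> components (?p ` ?V)" for C
  proof -
    from C im have C': "C \<in> components (\<phi> ` U)" by simp
    then obtain c where "\<forall>x\<in>C. inv_into U \<phi> x = x + c" using 2 by blast
    moreover have "C \<subseteq> \<phi> ` U" using C' by (rule in_components_subset)
    ultimately have "\<forall>x\<in>C. inv_into ?V ?p x = x + (c + b)" using ii by (auto simp: add.assoc subset_iff)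
    thus ?thesis by blast
  qed
  have B: "\<exists>c. \<forall>x \<in> C. ?p x = x + c" if C: "C \<in> components ?V" for C
  proof -
    from C have Cs: "connected C" "C \<subseteq> ?V" "C \<noteq> {}"
      by (auto intro: in_components_connected dest: in_components_subset in_components_nonempty)
    have "connected ((\<lambda>x. x - b) ` C)"
      by (intro connected_continuous_image continuous_intros Cs)
    moreover have "(\<lambda>x. x - b) ` C \<subseteq> U" using Cs(2) by auto
    ultimately obtain D where "D \<in> components U" "(\<lambda>x. x - b) ` C \<subseteq> D"
      using Cs(3) exists_component_superset[of "(\<lambda>x. x - b) ` C" U] by auto
    moreover then obtain c where "\<forall>x\<in>D. \<phi> x = x + c" using 3 by blast
    ultimately have "\<forall>x\<in>C. ?p x = x + (c - b)" using Cs(2) by (auto simp: image_subset_iff subset_iff)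
    thus ?thesis by blast
  qed
  show ?thesis unfolding inv plane_chart_iff using ch A B by blast
qed

lemma plane_isomorphism_iff:
  "translation_isomorphism plane plane T \<longleftrightarrow> (\<exists>b. \<forall>x. T x = x + b)"
proof
  assume *: "translation_isomorphism plane plane T"
  have id: "(UNIV, id) \<in> atlas plane"
    unfolding plane_chart_iff is_chart_def prod.case
    by (auto intro!: exI[of _ 0] exI[of _ id] simp: homeomorphism_def inv_into_def)
  from * obtain T' where T: "homeomorphism UNIV UNIV T T'"
    unfolding translation_isomorphism_def plane_def by auto
  have bij: "bij T" using T by (metis UNIV_I bijI' homeomorphism_def)
  have "(UNIV, inv T) \<in> {(T ` U, restrict (\<phi> \<circ> inv_into (points plane) T) (T ` U)) | U \<phi>. (U, \<phi>) \<in> atlas plane}"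
    using id bij by (auto intro!: exI[of _ UNIV] exI[of _ id] simp: plane_def restrict_UNIV bij_is_surj)
  hence "(UNIV, inv T) \<in> atlas plane" using * unfolding translation_isomorphism_def by simp
  then obtain b where b: "\<And>x. inv T x = x + b" unfolding plane_chart_iff by (auto simp: components_eq_sing_iff[THEN iffD2])
  have "T x = x + (- b)" for x using b[of "T x"] bij by (simp add: bij_is_inj eq_diff_eq)
  thus "\<exists>b. \<forall>x. T x = x + b" by blast
next
  assume "\<exists>b. \<forall>x. T x = x + b"
  then obtain b where T: "T = (\<lambda>x. x + b)" by blast
  have inv: "inv T = (\<lambda>x. x - b)" unfolding T by (intro inv_unique_comp) auto
  have inv': "inv (\<lambda>x. x + - b) = (\<lambda>x. x + b)" by (intro inv_unique_comp) auto
  have "homeomorphism UNIV UNIV T (\<lambda>x. x - b)"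
    unfolding T homeomorphism_def by (auto intro!: continuous_intros surjI[of _ "\<lambda>x. x - b"] surjI[of _ "\<lambda>x. x + b"])
  moreover have "(U, \<phi>) \<in> {(T ` U, restrict (\<phi> \<circ> inv T) (T ` U)) | U \<phi>. (U, \<phi>) \<in> atlas plane}"
    if a: "(U, \<phi>) \<in> atlas plane" for U \<phi>
  proof -
    let ?W = "(\<lambda>x. x + - b) ` U" and ?q = "restrict (\<phi> \<circ> (\<lambda>x. x + b)) ((\<lambda>x. x + - b) ` U)"
    have "(?W, ?q) \<in> atlas plane" using shift_chart[OF a, of "-b"] unfolding inv' .
    moreover have TW: "T ` ?W = U" by (auto simp: T image_image)
    moreover have "restrict (?q \<circ> inv T) U = \<phi>"
    proof
      fix x
      have "\<phi> \<in> extensional U" using a unfolding plane_chart_iff is_chart_def by auto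
      thus "restrict (?q \<circ> inv T) U x = \<phi> x"
        by (auto simp: inv extensional_def)
    qed
    ultimately show ?thesis by (smt (verit) mem_Collect_eq)
  qed
  moreover have "(T ` U, restrict (\<phi> \<circ> inv T) (T ` U)) \<in> atlas plane" if "(U, \<phi>) \<in> atlas plane" for U \<phi>
    using shift_chart[OF that, of b] unfolding T .
  ultimately show "translation_isomorphism plane plane T"
    unfolding translation_isomorphism_def by (auto simp: plane_def)
qed

section \<open>Infinite hyperelliptic curves\<close>

definition curve_points :: "(complex \<Rightarrow> complex) \<Rightarrow> (complex \<times> complex) set" where
  "curve_points f = {(z, w). w\<^sup>2 = f z}"

definition curve_Sing :: "(complex \<Rightarrow> complex) \<Rightarrow> (complex \<times> complex) set" where
  "curve_Sing f = {(z, 0) | z. f z = 0}"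

lemma curve_Sing_weierstrass_map:
  assumes "weierstrass_map z f"
  shows "curve_Sing f = {(z k, 0) | k. True}"
  using weierstrass_map_zeros[OF assms] by (auto simp: curve_Sing_def)

definition hyperelliptic_curve :: "(complex \<Rightarrow> complex) \<Rightarrow> (complex \<times> complex) translation_surface" where
  "hyperelliptic_curve f =
     \<lparr>points = curve_points f,
      Sing = curve_Sing f,
      atlas = pullback_atlas (curve_points f - curve_Sing f) fst (standard_atlas {z. f z \<noteq> 0})\<rparr>"

definition fiber_preserving_isomorphism ::
    "(complex \<Rightarrow> complex) \<Rightarrow> (complex \<Rightarrow> complex) \<Rightarrow> (complex \<times> complex \<Rightarrow> complex \<times> complex) \<Rightarrow> bool" where
  "fiber_preserving_isomorphism f g T \<longleftrightarrow>
     translation_isomorphism (hyperelliptic_curve f) (hyperelliptic_curve g) T \<and>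
     (\<forall>z. f z \<noteq> 0 \<longrightarrow>
        (\<forall>P \<in> curve_points f. \<forall>Q \<in> curve_points f.
           fst P = z \<and> fst Q = z \<longrightarrow> fst (T P) = fst (T Q)))"

end

theory Submission
  imports Defs
begin

text \<open>
  A chart belongs to the translation atlas of \<open>S(f)\<close> iff it differs from the projection \<open>fst\<close> by
  locally constant functions. Hence an isomorphism \<open>T\<close> satisfies \<open>fst \<circ> T = fst + b\<close> with \<open>b\<close>
  locally constant off the singular points; if \<open>T\<close> preserves fibers, \<open>b\<close> descends to the connected set
  of nonzeros of \<open>f\<close>, so it is constant, and by continuity the translation by \<open>b\<close> carries zeros to
  zeros. Conversely, if \<open>x \<mapsto> x + b\<close> carries the zeros of \<open>f\<close> to those of \<open>g\<close>, then, all zeros being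
  simple, \<open>g(x + b) / f(x)\<close> is entire and zero-free, hence a square \<open>s(x)\<^sup>2\<close>, and
  \<open>(x, w) \<mapsto> (x + b, s(x) w)\<close> is the required isomorphism.
\<close>

section \<open>Weierstrass products: holomorphy and simplicity of the zeros\<close>

lemma weierstrass_term_holomorphic: "weierstrass_term z d k holomorphic_on A"
  unfolding weierstrass_term_def by (cases "z k = 0") (auto intro!: holomorphic_intros)

lemma weierstrass_term_eq_0_iff: "weierstrass_term z d k x = 0 \<longleftrightarrow> z k \<noteq> 0 \<and> x = z k"
  by (auto simp: weierstrass_term_def divide_simps)

text \<open>In the product rule the summand containing the derivative of \<open>v\<close> is
  multiplied by \<open>u a = 0\<close>. This isolates the derivative at a simple zero without
  computing that of the cofactor.\<close>

lemma has_field_derivative_mult_zero: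
  fixes u v :: "complex \<Rightarrow> complex"
  assumes "(u has_field_derivative u') (at a)" "v field_differentiable at a" "u a = 0"
  shows "((\<lambda>x. u x * v x) has_field_derivative u' * v a) (at a)"
proof -
  obtain v' where "(v has_field_derivative v') (at a)"
    using assms(2) unfolding field_differentiable_def by blast
  from DERIV_mult[OF assms(1) this] show ?thesis using assms(3) by simp
qed

text \<open>The linear factor has derivative \<open>- 1 / z k\<close> at its zero, and its cofactor
  is an exponential, hence nonzero.\<close>

lemma weierstrass_term_deriv:
  assumes "z k \<noteq> 0"
  shows "\<exists>D. (weierstrass_term z d k has_field_derivative D) (at (z k)) \<and> D \<noteq> 0"
proof -
  let ?v = "\<lambda>x. exp (\<Sum>j=1..d k. (x / z k) ^ j / of_nat j)"
  have eq: "weierstrass_term z d k = (\<lambda>x. (1 - x / z k) * ?v x)"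
    using assms by (auto simp: weierstrass_term_def weierstrass_factor_def)
  have u: "((\<lambda>x. 1 - x / z k) has_field_derivative - 1 / z k) (at (z k))"
    using assms by (auto intro!: derivative_eq_intros)
  have "?v holomorphic_on UNIV" using assms by (intro holomorphic_intros) auto
  hence v: "?v field_differentiable at (z k)"
    by (meson UNIV_I holomorphic_on_imp_differentiable_at open_UNIV)
  show ?thesis unfolding eq
    using has_field_derivative_mult_zero[OF u v] assms by auto
qed

text \<open>Locally uniform limits of holomorphic functions may be differentiated termwise. The
  limit of the derivatives is recorded as well, because the derivative at a zero is computed from
  the partial products.\<close>

lemma weierstrass_product_has_derivative:
  assumes "\<And>x. convergent_prod (\<lambda>k. weierstrass_term z d k x)"
    and "\<And>K. compact K \<Longrightarrow> uniformly_convergent_on K (\<lambda>n x. \<Prod>k<n. weierstrass_term z d k x)"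
  shows "\<exists>P'. ((\<lambda>x. \<Prod>k. weierstrass_term z d k x) has_field_derivative P') (at a) \<and>
           (\<lambda>n. deriv (\<lambda>x. \<Prod>k<n. weierstrass_term z d k x) a) \<longlonglongrightarrow> P'"
proof -
  let ?p = "\<lambda>n x. \<Prod>k<n. weierstrass_term z d k x"
  let ?P = "\<lambda>x. \<Prod>k. weierstrass_term z d k x"
  have lim: "(\<lambda>n. ?p n x) \<longlonglongrightarrow> ?P x" for x
    using convergent_prod_LIMSEQ[OF assms(1)[of x]] LIMSEQ_lessThan_iff_atMost by blast
  \<comment> \<open>Uniform convergence on a disc provides only some limit \<open>l\<close>;
    uniqueness of pointwise limits identifies it with the infinite product.\<close>
  have ul: "uniform_limit (cball x 1) ?p ?P sequentially" for x
  proof -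
    obtain l where l: "uniform_limit (cball x 1) ?p l sequentially"
      using assms(2)[of "cball x 1"] unfolding uniformly_convergent_on_def by auto
    moreover have "l y = ?P y" if "y \<in> cball x 1" for y
      using tendsto_uniform_limitI[OF l that] lim[of y] LIMSEQ_unique by blast
    ultimately show ?thesis using uniform_limit_cong'[of "cball x 1" ?p ?p l ?P] by blast
  qed
  have hol: "?p n holomorphic_on UNIV" for n
    by (intro holomorphic_intros weierstrass_term_holomorphic)
  have d: "(?p n has_field_derivative deriv (?p n) x) (at x)" for n x
    using holomorphic_derivI[OF hol open_UNIV] by auto
  show ?thesis
    using has_complex_derivative_uniform_sequence[OF open_UNIV, of ?p "\<lambda>n. deriv (?p n)" ?P] d ul
    by (metis UNIV_I subset_UNIV zero_less_one)
qed

text \<open>The zeros are simple: the derivative at \<open>z k\<close> of a long partial product is a fixed nonzero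
  factor times a partial product of the remaining terms, which tends to a nonzero limit.\<close>
lemma weierstrass_product_deriv_nonzero:
  assumes "inj z" "z k \<noteq> 0"
    and "\<And>x. convergent_prod (\<lambda>k. weierstrass_term z d k x)"
    and "\<And>K. compact K \<Longrightarrow> uniformly_convergent_on K (\<lambda>n x. \<Prod>k<n. weierstrass_term z d k x)"
  shows "\<exists>P'. ((\<lambda>x. \<Prod>k. weierstrass_term z d k x) has_field_derivative P') (at (z k)) \<and> P' \<noteq> 0"
proof -
  let ?t = "weierstrass_term z d" and ?a = "z k"
  let ?p = "\<lambda>n x. \<Prod>j<n. ?t j x"
  define c where "c j = (if j = k then 1 else ?t j ?a)" for j
  obtain P' where P': "((\<lambda>x. \<Prod>k. ?t k x) has_field_derivative P') (at ?a)"
    "(\<lambda>n. deriv (?p n) ?a) \<longlonglongrightarrow> P'"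
    using weierstrass_product_has_derivative[OF assms(3,4)] by blast
  obtain D where D: "(?t k has_field_derivative D) (at ?a)" "D \<noteq> 0"
    using weierstrass_term_deriv assms(2) by blast
  \<comment> \<open>\<open>c\<close> differs from the sequence of terms at \<open>?a\<close> only at
    the index \<open>k\<close>, so both have the same tail after \<open>k\<close>, and the tail
    decides convergence.\<close>
  have "convergent_prod (\<lambda>j. ?t (j + Suc k) ?a)"
    using assms(3) convergent_prod_iff_shift[of "\<lambda>j. ?t j ?a"] by blast
  hence "convergent_prod (\<lambda>j. c (j + Suc k))" by (simp add: c_def)
  hence c: "convergent_prod c" using convergent_prod_iff_shift by blast
  have "c j \<noteq> 0" for j
    using assms(1,2) by (auto simp: c_def weierstrass_term_eq_0_iff inj_def)
  hence c0: "prodinf c \<noteq> 0"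
    using has_prod_eq_0_iff[OF convergent_prod_has_prod[OF c]] by (metis rangeE)
  have clim: "(\<lambda>n. \<Prod>j<n. c j) \<longlonglongrightarrow> prodinf c"
    using convergent_prod_LIMSEQ[OF c] LIMSEQ_lessThan_iff_atMost by blast
  have "deriv (?p n) ?a = D * (\<Prod>j<n. c j)" if "n > k" for n
  proof -
    let ?q = "\<lambda>x. \<Prod>j\<in>{..<n}-{k}. ?t j x"
    have eq: "?p n = (\<lambda>x. ?t k x * ?q x)" using that by (auto simp: prod.remove)
    have "?q holomorphic_on UNIV" by (intro holomorphic_intros weierstrass_term_holomorphic)
    hence "?q field_differentiable at ?a"
      by (meson UNIV_I holomorphic_on_imp_differentiable_at open_UNIV)
    hence "(?p n has_field_derivative D * ?q ?a) (at ?a)" unfolding eq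
      by (rule has_field_derivative_mult_zero[OF D(1)]) (use assms(2) in \<open>simp add: weierstrass_term_eq_0_iff\<close>)
    moreover have "(\<Prod>j<n. c j) = c k * (\<Prod>j\<in>{..<n}-{k}. c j)" using that by (simp add: prod.remove)
    moreover have "(\<Prod>j\<in>{..<n}-{k}. c j) = ?q ?a" by (intro prod.cong) (auto simp: c_def)
    ultimately show ?thesis by (simp add: DERIV_imp_deriv c_def)
  qed
  hence "\<forall>\<^sub>F n in sequentially. D * (\<Prod>j<n. c j) = deriv (?p n) ?a"
    using eventually_mono[OF eventually_gt_at_top[of k]] by (metis (mono_tags, lifting))
  hence "(\<lambda>n. deriv (?p n) ?a) \<longlonglongrightarrow> D * prodinf c"
    by (rule Lim_transform_eventually[OF tendsto_mult_left[OF clim, of D]])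
  hence "P' = D * prodinf c" using P'(2) LIMSEQ_unique by blast
  thus ?thesis using P'(1) D(2) c0 by auto
qed

lemma weierstrass_map_holomorphic:
  assumes "weierstrass_map z f"
  shows "f holomorphic_on UNIV"
proof -
  obtain h d where h: "h holomorphic_on UNIV"
    and c: "\<And>x. convergent_prod (\<lambda>k. weierstrass_term z d k x)"
      "\<And>K. compact K \<Longrightarrow> uniformly_convergent_on K (\<lambda>n x. \<Prod>k<n. weierstrass_term z d k x)"
    and f: "\<And>x. f x = h x * x ^ (if 0 \<in> range z then 1 else 0) * (\<Prod>k. weierstrass_term z d k x)"
    using assms unfolding weierstrass_map_def by blast
  have "(\<lambda>x. \<Prod>k. weierstrass_term z d k x) holomorphic_on UNIV"
    using weierstrass_product_has_derivative[OF c] by (metis holomorphic_on_open open_UNIV)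
  hence "(\<lambda>x. h x * x ^ (if 0 \<in> range z then 1 else 0) * (\<Prod>k. weierstrass_term z d k x)) holomorphic_on UNIV"
    using h by (intro holomorphic_intros)
  moreover have "f = (\<lambda>x. h x * x ^ (if 0 \<in> range z then 1 else 0) * (\<Prod>k. weierstrass_term z d k x))"
    using f by blast
  ultimately show ?thesis by metis
qed

text \<open>A zero at the origin comes from the power of \<open>x\<close>, since the product skips
  the index of a vanishing \<open>z k\<close> and so is nonzero there. Any other zero comes from the
  product, where the prefactor made of \<open>h\<close> and the power of \<open>x\<close> is
  nonzero. In both cases a simple zero is multiplied by a nonvanishing cofactor.\<close>

lemma weierstrass_map_deriv_nonzero:
  assumes "weierstrass_map z f" "inj z" "f a = 0"
  shows "deriv f a \<noteq> 0"
proof -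
  obtain h d where h: "h holomorphic_on UNIV" "\<And>x. h x \<noteq> 0"
    and c: "\<And>x. convergent_prod (\<lambda>k. weierstrass_term z d k x)"
      "\<And>K. compact K \<Longrightarrow> uniformly_convergent_on K (\<lambda>n x. \<Prod>k<n. weierstrass_term z d k x)"
    and f: "\<And>x. f x = h x * x ^ (if 0 \<in> range z then 1 else 0) * (\<Prod>k. weierstrass_term z d k x)"
    using assms(1) unfolding weierstrass_map_def by blast
  let ?P = "\<lambda>x. \<Prod>k. weierstrass_term z d k x"
  have hd: "h field_differentiable at a"
    using h(1) by (meson UNIV_I holomorphic_on_imp_differentiable_at open_UNIV)
  have Pd: "?P field_differentiable at a"
    using weierstrass_product_has_derivative[OF c, of a] unfolding field_differentiable_def by blast
  have P0: "?P x = 0 \<longleftrightarrow> (\<exists>k. z k \<noteq> 0 \<and> x = z k)" for x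
    unfolding has_prod_eq_0_iff[OF convergent_prod_has_prod[OF c(1)[of x]]]
    by (auto simp: weierstrass_term_eq_0_iff image_iff eq_commute[of 0])
  obtain k where k: "a = z k" using weierstrass_map_zeros[OF assms(1)] assms(3) by blast
  show ?thesis
  proof (cases "a = 0")
    case True
    hence "0 \<in> range z" using k by (metis rangeI)
    hence "f = (\<lambda>x. x * (h x * ?P x))" using f by (auto simp: mult_ac)
    moreover have "(\<lambda>x. h x * ?P x) field_differentiable at a"
      using hd Pd by (rule field_differentiable_mult)
    ultimately have "(f has_field_derivative 1 * (h a * ?P a)) (at a)"
      using has_field_derivative_mult_zero[OF DERIV_ident] True by blast
    moreover have "?P a \<noteq> 0" using P0 True by auto
    ultimately show ?thesis using h(2) by (simp add: DERIV_imp_deriv)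
  next
    case False
    let ?m = "if 0 \<in> range z then 1 else 0 :: nat"
    obtain P' where P': "(?P has_field_derivative P') (at a)" "P' \<noteq> 0"
      using weierstrass_product_deriv_nonzero[OF assms(2) _ c] False k by blast
    have "f = (\<lambda>x. ?P x * (h x * x ^ ?m))" using f by (auto simp: mult_ac)
    moreover have "(\<lambda>x. h x * x ^ ?m) field_differentiable at a"
      by (intro field_differentiable_mult hd field_differentiable_power field_differentiable_ident)
    moreover have "?P a = 0" using P0 False k by blast
    ultimately have "(f has_field_derivative P' * (h a * a ^ ?m)) (at a)"
      using has_field_derivative_mult_zero[OF P'(1), of "\<lambda>x. h x * x ^ ?m"] by simp
    thus ?thesis using h(2) False P'(2) by (auto simp: DERIV_imp_deriv split: if_splits)
  qed
qed

section \<open>Functions with the same simple zeros differ by the square of a zero-free entire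
  function\<close>

text \<open>The quotient \<open>g / f\<close> has removable singularities, and its values there
  are quotients of derivatives.\<close>
lemma same_simple_zeros_eq_square_mult:
  assumes f: "f holomorphic_on UNIV" and g: "g holomorphic_on UNIV"
    and zeros: "\<And>x. f x = 0 \<longleftrightarrow> g x = 0"
    and f': "\<And>x. f x = 0 \<Longrightarrow> deriv f x \<noteq> 0" and g': "\<And>x. g x = 0 \<Longrightarrow> deriv g x \<noteq> 0"
  obtains s where "s holomorphic_on UNIV" "\<And>x. s x \<noteq> 0" "\<And>x. g x = (s x)\<^sup>2 * f x"
proof -
  define q where "q x = (if f x = 0 then deriv g x / deriv f x else g x / f x)" for x
  have fd: "(f has_field_derivative deriv f x) (at x)" and gd: "(g has_field_derivative deriv g x) (at x)" for x
    using f g by (auto intro: holomorphic_derivI)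
  have contf: "continuous_on UNIV f" using f by (rule holomorphic_on_imp_continuous_on)
  have "\<exists>r>0. q holomorphic_on ball a r" for a
  proof -
    have "\<exists>r>0. \<forall>x\<in>ball a r - {a}. f x \<noteq> 0"
    proof (cases "f a = 0")
      case False
      then obtain r where "r > 0" "ball a r \<subseteq> - (f -` {0})"
        using open_vimage[of "- {0}" f] contf openE[of "- (f -` {0})" a] by (auto simp: vimage_Compl)
      thus ?thesis by (intro exI[of _ r]) auto
    next
      case True
      \<comment> \<open>The difference quotient of \<open>f\<close> at \<open>a\<close> tends to a
        nonzero limit, so it is eventually nonzero: the zero is isolated.\<close>
      have "\<forall>\<^sub>F x in at a. f x \<noteq> f a"
        using tendsto_imp_eventually_ne[OF fd[of a, unfolded has_field_derivative_iff] f'[OF True]]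
        by (auto elim!: eventually_mono)
      thus ?thesis using True by (auto simp: eventually_at dist_commute)
    qed
    then obtain r where r: "r > 0" "\<And>x. x \<in> ball a r - {a} \<Longrightarrow> f x \<noteq> 0" by blast
    have "(\<lambda>x. g x / f x) holomorphic_on (ball a r - {a})"
      using r f g by (intro holomorphic_on_divide) (auto intro: holomorphic_on_subset)
    hence hol: "q holomorphic_on (ball a r - {a})"
      by (rule holomorphic_transform) (use r in \<open>auto simp: q_def\<close>)
    have "(q \<longlongrightarrow> q a) (at a)"
    proof (cases "f a = 0")
      case False
      have "((\<lambda>x. g x / f x) \<longlongrightarrow> g a / f a) (at a)"
        using DERIV_isCont[OF fd] DERIV_isCont[OF gd] False by (intro tendsto_divide) (auto simp: isCont_def)
      moreover have "\<forall>\<^sub>F x in at a. g x / f x = q x"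
        using r by (auto simp: eventually_at q_def dist_commute intro!: exI[of _ r])
      ultimately show ?thesis using False by (auto simp: q_def intro: Lim_transform_eventually)
    next
      case True
      \<comment> \<open>As \<open>f a = g a = 0\<close>, the quotient of the two difference
        quotients is \<open>g x / f x\<close>.\<close>
      have "((\<lambda>x. ((g x - g a) / (x - a)) / ((f x - f a) / (x - a))) \<longlongrightarrow> deriv g a / deriv f a) (at a)"
        using tendsto_divide[OF gd[of a, unfolded has_field_derivative_iff]
            fd[of a, unfolded has_field_derivative_iff] f'[OF True]] .
      moreover have "\<forall>\<^sub>F x in at a. ((g x - g a) / (x - a)) / ((f x - f a) / (x - a)) = q x"
        using r True zeros[of a] by (auto simp: eventually_at q_def dist_commute intro!: exI[of _ r])
      ultimately show ?thesis using True by (auto simp: q_def intro: Lim_transform_eventually)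
    qed
    hence "(q \<longlongrightarrow> q x) (at x within ball a r)" if "x \<in> {a}" for x
      using that tendsto_within_subset by blast
    hence "q holomorphic_on ball a r"
      using hol by (rule no_isolated_singularity') auto
    thus ?thesis using r by blast
  qed
  hence "q holomorphic_on UNIV"
    by (metis centre_in_ball field_differentiable_at_within holomorphic_on_def
        holomorphic_on_imp_differentiable_at open_ball)
  moreover have q0: "q x \<noteq> 0" for x using zeros f' g' by (auto simp: q_def)
  \<comment> \<open>A zero-free holomorphic function on the contractible plane has a holomorphic
    square root.\<close>
  ultimately obtain s where s: "s holomorphic_on UNIV" "\<And>x. q x = (s x)\<^sup>2"
    using contractible_imp_holomorphic_sqrt[of q UNIV] by (metis UNIV_I contractible_UNIV)
  moreover have "g x = q x * f x" for x using zeros by (auto simp: q_def)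
  moreover have "s x \<noteq> 0" for x using q0[of x] s(2)[of x] by auto
  ultimately show ?thesis using that by auto
qed

section \<open>Translation atlases described by local agreement with a projection up to
  constants\<close>

text \<open>Compatibility with \<open>p\<close> is stated through neighbourhoods instead of
  components of overlaps. Thus \<open>p\<close> itself need not be injective, and no inverse of a
  coordinate function occurs.\<close>

definition locally_translates :: "'a::topological_space set \<Rightarrow> ('a \<Rightarrow> complex) \<Rightarrow> 'a chart \<Rightarrow> bool" where
  "locally_translates X p c \<longleftrightarrow> (\<forall>P \<in> fst c. \<exists>W b. openin (top_of_set X) W \<and> P \<in> W \<and> W \<subseteq> fst c \<and>
     (\<forall>Q \<in> W. snd c Q = p Q + b))"

lemma locally_translatesE:
  assumes "locally_translates X p (U, \<phi>)" "P \<in> U"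
  obtains W b where "openin (top_of_set X) W" "P \<in> W" "W \<subseteq> U" "\<And>Q. Q \<in> W \<Longrightarrow> \<phi> Q = p Q + b"
  using assms unfolding locally_translates_def by (metis fst_conv snd_conv)

lemma is_chartE:
  assumes "is_chart X (U, \<phi>)"
  obtains \<psi> where "openin (top_of_set X) U" "U \<subseteq> X" "\<phi> \<in> extensional U" "open (\<phi> ` U)"
    "homeomorphism U (\<phi> ` U) \<phi> \<psi>" "inj_on \<phi> U" "continuous_on U \<phi>"
proof -
  obtain \<psi> where "homeomorphism U (\<phi> ` U) \<phi> \<psi>" using assms unfolding is_chart_def by auto
  moreover from this have "inj_on \<phi> U" "continuous_on U \<phi>"
    unfolding homeomorphism_def by (auto intro: inj_on_inverseI)
  ultimately show ?thesis using assms that unfolding is_chart_def by (auto dest: openin_imp_subset)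
qed

lemma is_chart_image_open:
  assumes "is_chart X (U, \<phi>)" "openin (top_of_set X) W" "W \<subseteq> U"
  shows "open (\<phi> ` W)"
proof -
  obtain \<psi> where U: "U \<subseteq> X" "open (\<phi> ` U)" "homeomorphism U (\<phi> ` U) \<phi> \<psi>"
    using assms(1) by (rule is_chartE)
  have "openin (top_of_set U) W" using assms(2,3) U(1) by (rule openin_subset_trans)
  thus ?thesis using homeomorphism_imp_open_map[OF U(3)] U(2) openin_open_eq by blast
qed

text \<open>Near each point of the overlap both coordinates are \<open>p\<close> plus a constant.
  The transition map minus the identity is therefore locally constant, hence constant on each
  component.\<close>

lemma locally_translates_imp_translation_transition:
  assumes U: "is_chart X (U, \<phi>)" "locally_translates X p (U, \<phi>)"
    and V: "locally_translates X p (V, \<psi>)"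
  shows "translation_transition (U, \<phi>) (V, \<psi>)"
  unfolding translation_transition_def prod.case
proof
  fix C assume C: "C \<in> components (\<phi> ` (U \<inter> V))"
  have inj: "inj_on \<phi> U" using U(1) by (rule is_chartE)
  have "(\<lambda>y. \<psi> (inv_into U \<phi> y) - y) constant_on C"
  proof (rule locally_constant_imp_constant)
    show "connected C" using C by (rule in_components_connected)
    fix y assume y: "y \<in> C"
    then obtain P where P: "P \<in> U" "P \<in> V" "y = \<phi> P" using in_components_subset[OF C] by blast
    obtain W1 b1 where W1: "openin (top_of_set X) W1" "P \<in> W1" "W1 \<subseteq> U" "\<And>Q. Q \<in> W1 \<Longrightarrow> \<phi> Q = p Q + b1"
      using locally_translatesE[OF U(2) P(1)] by metis
    obtain W2 b2 where W2: "openin (top_of_set X) W2" "P \<in> W2" "W2 \<subseteq> V" "\<And>Q. Q \<in> W2 \<Longrightarrow> \<psi> Q = p Q + b2"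
      using locally_translatesE[OF V P(2)] by metis
    have "open (\<phi> ` (W1 \<inter> W2))"
      using W1 W2 by (intro is_chart_image_open[OF U(1)]) (auto intro: openin_Int)
    hence "openin (top_of_set C) (C \<inter> \<phi> ` (W1 \<inter> W2))" by (rule openin_open_Int)
    moreover have "\<psi> (inv_into U \<phi> x) - x = b2 - b1" if "x \<in> \<phi> ` (W1 \<inter> W2)" for x
    proof -
      from that obtain Q where Q: "Q \<in> W1" "Q \<in> W2" "x = \<phi> Q" by blast
      hence "inv_into U \<phi> x = Q" using W1(3) inj by auto
      thus ?thesis using Q W1(4) W2(4) by simp
    qed
    moreover have "y \<in> \<phi> ` (W1 \<inter> W2)" using P W1 W2 by blast
    ultimately show "\<exists>T. openin (top_of_set C) T \<and> y \<in> T \<and>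
        (\<forall>x\<in>T. \<psi> (inv_into U \<phi> x) - x = \<psi> (inv_into U \<phi> y) - y)"
      using y by (intro exI[of _ "C \<inter> \<phi> ` (W1 \<inter> W2)"]) auto
  qed
  then obtain b where "\<And>x. x \<in> C \<Longrightarrow> \<psi> (inv_into U \<phi> x) - x = b" unfolding constant_on_def by blast
  hence "\<forall>x\<in>C. \<psi> (inv_into U \<phi> x) = x + b" by (auto simp: algebra_simps)
  thus "\<exists>b. \<forall>x\<in>C. \<psi> (inv_into U \<phi> x) = x + b" by blast
qed

text \<open>Around \<open>P\<close> some compatible chart \<open>\<psi>\<close> equals
  \<open>p + c\<close>, and the transition to \<open>\<phi>\<close> adds a constant \<open>b\<close>
  on the component containing \<open>\<psi> P\<close>, so \<open>\<phi>\<close> is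
  \<open>p + (c + b)\<close> near \<open>P\<close>.\<close>

lemma translation_transition_imp_locally_translates:
  assumes U: "is_chart X (U, \<phi>)"
    and cover: "\<And>P. P \<in> U \<Longrightarrow> \<exists>V \<psi>. P \<in> V \<and> is_chart X (V, \<psi>) \<and> locally_translates X p (V, \<psi>) \<and>
                  translation_transition (V, \<psi>) (U, \<phi>)"
  shows "locally_translates X p (U, \<phi>)"
  unfolding locally_translates_def fst_conv snd_conv
proof
  fix P assume P: "P \<in> U"
  obtain V \<psi> where V: "P \<in> V" "is_chart X (V, \<psi>)" "locally_translates X p (V, \<psi>)"
    and tr: "translation_transition (V, \<psi>) (U, \<phi>)" using cover[OF P] by blast
  obtain W c where W: "openin (top_of_set X) W" "P \<in> W" "W \<subseteq> V" "\<And>Q. Q \<in> W \<Longrightarrow> \<psi> Q = p Q + c"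
    using locally_translatesE[OF V(3,1)] by metis
  have oU: "openin (top_of_set X) U" using U by (rule is_chartE)
  have oV: "openin (top_of_set X) V" and inj: "inj_on \<psi> V" and cont: "continuous_on V \<psi>"
    using V(2) by (auto elim: is_chartE)
  have S: "open (\<psi> ` (V \<inter> U))"
    by (intro is_chart_image_open[OF V(2)] openin_Int oU oV) auto
  have yS: "\<psi> P \<in> \<psi> ` (V \<inter> U)" using P V(1) by blast
  \<comment> \<open>The image of the overlap is open in the plane, so its components are open and
    \<open>C\<close> pulls back to a neighbourhood of \<open>P\<close>.\<close>
  define C where "C = connected_component_set (\<psi> ` (V \<inter> U)) (\<psi> P)"
  have C: "C \<in> components (\<psi> ` (V \<inter> U))" "open C" "\<psi> P \<in> C"
    using yS S by (auto simp: C_def components_def open_connected_component)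
  obtain b where b: "\<And>x. x \<in> C \<Longrightarrow> \<phi> (inv_into V \<psi> x) = x + b"
    using tr C(1) unfolding translation_transition_def by auto
  have "openin (top_of_set V) (V \<inter> \<psi> -` C)"
    using cont C(2) by (rule continuous_openin_preimage_gen)
  hence "openin (top_of_set X) (V \<inter> \<psi> -` C)" using oV openin_trans by blast
  hence "openin (top_of_set X) (W \<inter> U \<inter> (V \<inter> \<psi> -` C))" using W(1) oU by (blast intro: openin_Int)
  moreover have "\<phi> Q = p Q + (c + b)" if "Q \<in> W \<inter> U \<inter> (V \<inter> \<psi> -` C)" for Q
    using that b[of "\<psi> Q"] W(4)[of Q] inv_into_f_f[OF inj, of Q] by (simp add: add.assoc)
  ultimately show "\<exists>W b. openin (top_of_set X) W \<and> P \<in> W \<and> W \<subseteq> U \<and> (\<forall>Q\<in>W. \<phi> Q = p Q + b)"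
    using P V(1) W(2) C(3) by (intro exI[of _ "W \<inter> U \<inter> (V \<inter> \<psi> -` C)"] exI[of _ "c + b"]) auto
qed

text \<open>The generating atlas drops out of the description: any covering family of charts that
  are local translates of \<open>p\<close> generates the same maximal atlas. This serves both for
  plane domains, with \<open>p = id\<close>, and for curves, with \<open>p = fst\<close>.\<close>

lemma maximal_atlas_iff_locally_translates:
  assumes A: "\<And>a. a \<in> A \<Longrightarrow> is_chart X a \<and> locally_translates X p a"
    and cover: "\<And>P. P \<in> X \<Longrightarrow> \<exists>a \<in> A. P \<in> fst a"
  shows "c \<in> maximal_atlas X A \<longleftrightarrow> is_chart X c \<and> locally_translates X p c"
proof
  assume "c \<in> maximal_atlas X A"
  hence c: "is_chart X c" "\<And>a. a \<in> A \<Longrightarrow> translation_transition a c" by (auto simp: maximal_atlas_def)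
  obtain U \<phi> where [simp]: "c = (U, \<phi>)" by fastforce
  have UX: "U \<subseteq> X" using c(1) by (auto elim: is_chartE)
  have "locally_translates X p (U, \<phi>)"
  proof (rule translation_transition_imp_locally_translates)
    show "is_chart X (U, \<phi>)" using c by simp
    fix P assume "P \<in> U"
    then obtain a where "a \<in> A" "P \<in> fst a" using cover UX by blast
    thus "\<exists>V \<psi>. P \<in> V \<and> is_chart X (V, \<psi>) \<and> locally_translates X p (V, \<psi>) \<and>
                  translation_transition (V, \<psi>) (U, \<phi>)"
      using A c by (intro exI[of _ "fst a"] exI[of _ "snd a"]) auto
  qed
  thus "is_chart X c \<and> locally_translates X p c" using c by simp
next
  assume "is_chart X c \<and> locally_translates X p c"
  thus "c \<in> maximal_atlas X A"
    using A locally_translates_imp_translation_transition[of X "fst c" "snd c" p]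
      locally_translates_imp_translation_transition[of X _ _ p "fst c" "snd c"]
    by (auto simp: maximal_atlas_def)
qed

lemma is_chart_id:
  assumes "open V" "V \<subseteq> \<Omega>"
  shows "is_chart \<Omega> (V, restrict id V)" "locally_translates \<Omega> id (V, restrict id V)"
proof -
  have "openin (top_of_set \<Omega>) V" using assms by (meson open_subset)
  moreover have "homeomorphism V V (restrict id V) id"
    by (rule homeomorphism_cong[of V V id id]) (auto simp: homeomorphism_def)
  ultimately show "is_chart \<Omega> (V, restrict id V)"
    using assms(1) by (auto simp: is_chart_def)
  show "locally_translates \<Omega> id (V, restrict id V)"
    unfolding locally_translates_def using \<open>openin (top_of_set \<Omega>) V\<close>
    by (intro ballI exI[of _ V] exI[of _ "0::complex"]) auto
qed

lemma standard_atlas_iff: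
  assumes "open \<Omega>"
  shows "c \<in> standard_atlas \<Omega> \<longleftrightarrow> is_chart \<Omega> c \<and> locally_translates \<Omega> id c"
  unfolding standard_atlas_def
  by (rule maximal_atlas_iff_locally_translates) (use is_chart_id[OF assms] in auto)

lemma pullback_chart:
  assumes "open \<Omega>" "(V, \<phi>) \<in> standard_atlas \<Omega>" "openin (top_of_set X) U" "homeomorphism U V p q"
  shows "is_chart X (U, restrict (\<phi> \<circ> p) U)" "locally_translates X p (U, restrict (\<phi> \<circ> p) U)"
proof -
  have V: "is_chart \<Omega> (V, \<phi>)" "locally_translates \<Omega> id (V, \<phi>)"
    using assms(2) standard_atlas_iff[OF assms(1)] by auto
  obtain \<psi> where \<psi>: "open (\<phi> ` V)" "homeomorphism V (\<phi> ` V) \<phi> \<psi>" using V(1) by (rule is_chartE)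
  have pU: "p ` U = V" "continuous_on U p" using assms(4) by (auto simp: homeomorphism_def)
  have im: "restrict (\<phi> \<circ> p) U ` U = \<phi> ` V" using pU(1) by (force simp: image_iff)
  have "homeomorphism U (\<phi> ` V) (restrict (\<phi> \<circ> p) U) (q \<circ> \<psi>)"
    by (rule homeomorphism_cong[OF homeomorphism_compose[OF assms(4) \<psi>(2)]]) auto
  thus "is_chart X (U, restrict (\<phi> \<circ> p) U)"
    using assms(3) \<psi>(1) unfolding is_chart_def prod.case im by auto
  show "locally_translates X p (U, restrict (\<phi> \<circ> p) U)"
    unfolding locally_translates_def fst_conv snd_conv
  proof
    fix P assume P: "P \<in> U"
    hence "p P \<in> V" using pU by blast
    then obtain W b where W: "openin (top_of_set \<Omega>) W" "p P \<in> W" "W \<subseteq> V" "\<And>Q. Q \<in> W \<Longrightarrow> \<phi> Q = id Q + b"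
      using locally_translatesE[OF V(2)] by metis
    have "open W" using W(1) assms(1) openin_open_eq by blast
    hence "openin (top_of_set U) (U \<inter> p -` W)" by (rule continuous_openin_preimage_gen[OF pU(2)])
    hence "openin (top_of_set X) (U \<inter> p -` W)" using assms(3) openin_trans by blast
    thus "\<exists>W b. openin (top_of_set X) W \<and> P \<in> W \<and> W \<subseteq> U \<and> (\<forall>Q\<in>W. restrict (\<phi> \<circ> p) U Q = p Q + b)"
      using W P by (intro exI[of _ "U \<inter> p -` W"] exI[of _ b]) auto
  qed
qed

text \<open>The covering hypothesis expresses that \<open>p\<close> is a local homeomorphism into
  \<open>\<Omega>\<close>; identity charts pulled back along its local inverses cover
  \<open>X\<close>.\<close>

lemma pullback_atlas_iff:
  assumes "open \<Omega>"
    and cover: "\<And>P. P \<in> X \<Longrightarrow> \<exists>U V q. openin (top_of_set X) U \<and> P \<in> U \<and> open V \<and> V \<subseteq> \<Omega> \<and> homeomorphism U V p q"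
  shows "c \<in> pullback_atlas X p (standard_atlas \<Omega>) \<longleftrightarrow> is_chart X c \<and> locally_translates X p c"
  unfolding pullback_atlas_def
proof (rule maximal_atlas_iff_locally_translates, goal_cases)
  case (1 a)
  then obtain U V \<phi> q where "a = (U, restrict (\<phi> \<circ> p) U)" "(V, \<phi>) \<in> standard_atlas \<Omega>"
    "openin (top_of_set X) U" "homeomorphism U V p q" by blast
  thus ?case using pullback_chart[OF assms(1)] by metis
next
  case (2 P)
  then obtain U V q where U: "openin (top_of_set X) U" "P \<in> U" "open V" "V \<subseteq> \<Omega>" "homeomorphism U V p q"
    using cover by blast
  have V: "(V, restrict id V) \<in> standard_atlas \<Omega>"
    using standard_atlas_iff[OF assms(1)] is_chart_id[OF U(3,4)] by blast
  have q: "\<exists>q. homeomorphism U V p q" by (rule exI[of _ q]) (rule U(5))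
  have "(U, restrict (restrict id V \<circ> p) U) \<in> {(U, restrict (\<phi> \<circ> p) U) | U V \<phi>.
      (V, \<phi>) \<in> standard_atlas \<Omega> \<and> openin (top_of_set X) U \<and> (\<exists>q. homeomorphism U V p q)}"
    by (rule CollectI, rule exI, rule exI, rule exI, rule conjI[OF refl], rule conjI[OF V conjI[OF U(1) q]])
  moreover have "P \<in> fst (U, restrict (restrict id V \<circ> p) U)" using U(2) by simp
  ultimately show ?case by (rule bexI[rotated])
qed

text \<open>If \<open>\<phi> = p + c\<close> near \<open>P\<close>, then
  \<open>\<phi> \<circ> T' = p' + (c - b)\<close> near \<open>T P\<close>: a homeomorphism covering
  a translation only changes the additive constants.\<close>

lemma transport_chart:
  assumes T: "homeomorphism X Y T T'" and p: "\<And>P. P \<in> X \<Longrightarrow> p' (T P) = p P + b"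
    and U: "is_chart X (U, \<phi>)" "locally_translates X p (U, \<phi>)"
  shows "is_chart Y (T ` U, restrict (\<phi> \<circ> T') (T ` U))"
    "locally_translates Y p' (T ` U, restrict (\<phi> \<circ> T') (T ` U))"
proof -
  obtain \<psi> where \<psi>: "openin (top_of_set X) U" "U \<subseteq> X" "open (\<phi> ` U)" "homeomorphism U (\<phi> ` U) \<phi> \<psi>"
    using U(1) by (rule is_chartE)
  have T'T: "T' (T P) = P" if "P \<in> X" for P using T that by (rule homeomorphism_apply1)
  have im: "restrict (\<phi> \<circ> T') (T ` U) ` T ` U = \<phi> ` U"
    using T'T \<psi>(2) by (force simp: image_iff)
  have "homeomorphism (T ` U) U T' T"
    using homeomorphism_of_subsets[OF T \<psi>(2) _ refl, of Y] homeomorphism_symD by blast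
  hence "homeomorphism (T ` U) (\<phi> ` U) (restrict (\<phi> \<circ> T') (T ` U)) (T \<circ> \<psi>)"
    by (intro homeomorphism_cong[OF homeomorphism_compose[OF _ \<psi>(4)]]) auto
  thus "is_chart Y (T ` U, restrict (\<phi> \<circ> T') (T ` U))"
    using homeomorphism_imp_open_map[OF T \<psi>(1)] \<psi>(3) unfolding is_chart_def prod.case im by auto
  show "locally_translates Y p' (T ` U, restrict (\<phi> \<circ> T') (T ` U))"
    unfolding locally_translates_def fst_conv snd_conv
  proof
    fix P' assume "P' \<in> T ` U"
    then obtain P where P: "P \<in> U" "P' = T P" by blast
    obtain W c where W: "openin (top_of_set X) W" "P \<in> W" "W \<subseteq> U" "\<And>Q. Q \<in> W \<Longrightarrow> \<phi> Q = p Q + c"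
      using locally_translatesE[OF U(2) P(1)] by metis
    have "restrict (\<phi> \<circ> T') (T ` U) Q' = p' Q' + (c - b)" if "Q' \<in> T ` W" for Q'
    proof -
      from that obtain Q where Q: "Q \<in> W" "Q' = T Q" by blast
      hence "Q \<in> X" using W(3) \<psi>(2) by blast
      thus ?thesis using Q W(3,4) p T'T by auto
    qed
    thus "\<exists>W b. openin (top_of_set Y) W \<and> P' \<in> W \<and> W \<subseteq> T ` U \<and>
        (\<forall>Q\<in>W. restrict (\<phi> \<circ> T') (T ` U) Q = p' Q + b)"
      using homeomorphism_imp_open_map[OF T W(1)] W(2,3) P(2)
      by (intro exI[of _ "T ` W"] exI[of _ "c - b"]) auto
  qed
qed

section \<open>The translation atlas of a hyperelliptic curve\<close>

text \<open>On a disc where \<open>f\<close> has no zeros, \<open>f\<close> has a square root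
  \<open>s\<close>, and the sheet through \<open>P\<close> is the graph of \<open>s\<close>.\<close>

lemma curve_projection_local_homeomorphism:
  assumes f: "f holomorphic_on UNIV" and P: "P \<in> curve_points f - curve_Sing f"
  shows "\<exists>U V q. openin (top_of_set (curve_points f - curve_Sing f)) U \<and> P \<in> U \<and> open V \<and>
           V \<subseteq> {x. f x \<noteq> 0} \<and> homeomorphism U V fst q"
proof -
  let ?X = "curve_points f - curve_Sing f"
  obtain z0 w0 where P0: "P = (z0, w0)" by fastforce
  have w0: "w0\<^sup>2 = f z0" "f z0 \<noteq> 0" using P by (auto simp: P0 curve_points_def curve_Sing_def)
  have "continuous_on UNIV f" using f by (rule holomorphic_on_imp_continuous_on)
  hence "open {x. f x \<noteq> 0}" by (intro open_Collect_neq) auto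
  then obtain r where r: "r > 0" "ball z0 r \<subseteq> {x. f x \<noteq> 0}" using w0(2)
    by (auto elim: openE[of _ z0])
  have "f holomorphic_on ball z0 r" using f by (rule holomorphic_on_subset) simp
  moreover have "f x \<noteq> 0" if "x \<in> ball z0 r" for x using r(2) that by blast
  ultimately obtain s0 where s0: "s0 holomorphic_on ball z0 r" "\<And>x. x \<in> ball z0 r \<Longrightarrow> f x = (s0 x)\<^sup>2"
    using contractible_imp_holomorphic_sqrt[OF _ convex_imp_contractible[OF convex_ball]] by metis
  \<comment> \<open>The sign of the square root is chosen so that its graph passes through
    \<open>P\<close>.\<close>
  obtain s where s: "continuous_on (ball z0 r) s" "\<And>x. x \<in> ball z0 r \<Longrightarrow> f x = (s x)\<^sup>2" "s z0 = w0"
  proof -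
    have "w0 = s0 z0 \<or> w0 = - s0 z0" using s0(2)[of z0] w0(1) r(1) by (auto simp: power2_eq_iff)
    thus ?thesis
      using that[of s0] that[of "\<lambda>x. - s0 x"] s0 holomorphic_on_imp_continuous_on[OF s0(1)]
      by (auto intro: continuous_intros)
  qed
  define O' where "O' = ball z0 r \<times> (UNIV :: complex set)"
  \<comment> \<open>On the curve over the disc, the second coordinate is \<open>s\<close> or
    \<open>- s\<close> of the first. The open condition that its sum with \<open>s\<close> is
    nonzero removes the sheet of \<open>- s\<close>, so \<open>U\<close> is visibly open.\<close>
  define U where "U = ?X \<inter> (O' \<inter> (\<lambda>Q. snd Q + s (fst Q)) -` (- {0}))"
  have sn: "s x \<noteq> 0" if "x \<in> ball z0 r" for x using s(2)[OF that] r(2) that by auto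
  have Ueq: "U = (\<lambda>x. (x, s x)) ` ball z0 r"
  proof -
    have "Q \<in> U \<longleftrightarrow> fst Q \<in> ball z0 r \<and> snd Q = s (fst Q)" for Q
      using s(2)[of "fst Q"] sn[of "fst Q"] r(2)
      by (cases Q) (auto simp: U_def O'_def curve_points_def curve_Sing_def power2_eq_iff add_eq_0_iff2)
    thus ?thesis by (force simp: image_iff)
  qed
  have "continuous_on O' (\<lambda>Q. snd Q + s (fst Q))"
    unfolding O'_def by (intro continuous_intros continuous_on_compose2[OF s(1)]) auto
  moreover have "open O'" unfolding O'_def by (intro open_Times) auto
  ultimately have "open (O' \<inter> (\<lambda>Q. snd Q + s (fst Q)) -` (- {0}))"
    by (intro continuous_open_preimage) auto
  hence "openin (top_of_set ?X) U" unfolding U_def by (rule openin_open_Int)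
  moreover have "homeomorphism U (ball z0 r) fst (\<lambda>x. (x, s x))"
    unfolding Ueq by (auto simp: homeomorphism_def image_image intro!: continuous_intros s(1))
  moreover have "P \<in> U" using s(3) r(1) by (auto simp: Ueq P0)
  ultimately show ?thesis using r(2) by blast
qed

lemma hyperelliptic_atlas_iff:
  assumes "f holomorphic_on UNIV"
  shows "c \<in> atlas (hyperelliptic_curve f) \<longleftrightarrow>
    is_chart (curve_points f - curve_Sing f) c \<and> locally_translates (curve_points f - curve_Sing f) fst c"
proof -
  have "continuous_on UNIV f" using assms by (rule holomorphic_on_imp_continuous_on)
  hence "open {x. f x \<noteq> 0}" by (intro open_Collect_neq) auto
  thus ?thesis unfolding hyperelliptic_curve_def translation_surface.simps
    by (rule pullback_atlas_iff) (rule curve_projection_local_homeomorphism[OF assms])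
qed

section \<open>Isomorphisms of curves and translations of the first coordinate\<close>

lemma homeomorphism_curve_regular:
  assumes T: "homeomorphism (curve_points f) (curve_points g) T T'"
    and sing: "T ` curve_Sing f = curve_Sing g"
  shows "homeomorphism (curve_points f - curve_Sing f) (curve_points g - curve_Sing g) T T'"
proof -
  have inj: "inj_on T (curve_points f)" and im: "T ` curve_points f = curve_points g"
    using T by (auto simp: homeomorphism_def intro: inj_on_inverseI)
  have "curve_Sing f \<subseteq> curve_points f" by (auto simp: curve_Sing_def curve_points_def)
  hence "T ` (curve_points f - curve_Sing f) = T ` curve_points f - T ` curve_Sing f"
    by (intro inj_on_image_set_diff[OF inj]) auto
  thus ?thesis by (intro homeomorphism_of_subsets[OF T Diff_subset Diff_subset]) (simp only: im sing)
qed

text \<open>Transport along \<open>T\<close> gives one inclusion of atlases, and transport along the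
  inverse \<open>T'\<close>, which covers the translation by \<open>- b\<close>, gives the
  other.\<close>

lemma translation_isomorphism_hyperelliptic_curve:
  assumes f: "f holomorphic_on UNIV" and g: "g holomorphic_on UNIV"
    and T: "homeomorphism (curve_points f) (curve_points g) T T'"
    and sing: "T ` curve_Sing f = curve_Sing g"
    and fst: "\<And>P. P \<in> curve_points f \<Longrightarrow> fst (T P) = fst P + b"
  shows "translation_isomorphism (hyperelliptic_curve f) (hyperelliptic_curve g) T"
proof -
  let ?X = "curve_points f - curve_Sing f" and ?Y = "curve_points g - curve_Sing g"
  have inj: "inj_on T (curve_points f)"
    using T by (auto simp: homeomorphism_def intro: inj_on_inverseI)
  have TXY: "homeomorphism ?X ?Y T T'" using homeomorphism_curve_regular[OF T sing] .
  hence TX: "T ` ?X = ?Y" by (simp add: homeomorphism_def)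
  have inv: "inv_into (curve_points f) T Q = T' Q" if "Q \<in> curve_points g" for Q
    using T that by (intro inv_into_f_eq inj) (auto simp: homeomorphism_def)
  have fst': "fst (T' Q) = fst Q + - b" if "Q \<in> ?Y" for Q
  proof -
    have "T' Q \<in> curve_points f" using TXY that unfolding homeomorphism_def by blast
    from fst[OF this] show ?thesis using homeomorphism_apply2[OF TXY that] by simp
  qed
  have restr: "restrict (\<phi> \<circ> inv_into (curve_points f) T) V = restrict (\<phi> \<circ> T') V" if "V \<subseteq> ?Y" for V and \<phi> :: "complex \<times> complex \<Rightarrow> complex"
    using that inv by (intro restrict_ext) auto
  have "c \<in> atlas (hyperelliptic_curve g) \<longleftrightarrow>
      (\<exists>U \<phi>. c = (T ` U, restrict (\<phi> \<circ> inv_into (curve_points f) T) (T ` U)) \<and> (U, \<phi>) \<in> atlas (hyperelliptic_curve f))" for c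
  proof
    assume c: "c \<in> atlas (hyperelliptic_curve g)"
    obtain V \<psi> where [simp]: "c = (V, \<psi>)" by fastforce
    have V: "is_chart ?Y (V, \<psi>)" "locally_translates ?Y fst (V, \<psi>)"
      using c hyperelliptic_atlas_iff[OF g] by auto
    hence VY: "V \<subseteq> ?Y" and ext: "\<psi> \<in> extensional V" by (auto elim: is_chartE)
    have "(T' ` V, restrict (\<psi> \<circ> T) (T' ` V)) \<in> atlas (hyperelliptic_curve f)"
      using transport_chart[OF homeomorphism_symD[OF TXY] fst' V] hyperelliptic_atlas_iff[OF f] by auto
    moreover have TT': "T (T' Q) = Q" if "Q \<in> V" for Q using homeomorphism_apply2[OF TXY] VY that by blast
    hence TV: "T ` T' ` V = V" by (simp add: image_image)
    \<comment> \<open>Going back and forth recovers \<open>\<psi>\<close> on \<open>V\<close>;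
      extensionality makes the two charts equal as functions.\<close>
    moreover have "\<psi> = restrict (restrict (\<psi> \<circ> T) (T' ` V) \<circ> T') V"
      using TT' ext by (intro extensionalityI[of _ V]) auto
    ultimately show "\<exists>U \<phi>. c = (T ` U, restrict (\<phi> \<circ> inv_into (curve_points f) T) (T ` U)) \<and> (U, \<phi>) \<in> atlas (hyperelliptic_curve f)"
      using restr[OF VY] by (intro exI[of _ "T' ` V"] exI[of _ "restrict (\<psi> \<circ> T) (T' ` V)"]) simp
  next
    assume "\<exists>U \<phi>. c = (T ` U, restrict (\<phi> \<circ> inv_into (curve_points f) T) (T ` U)) \<and> (U, \<phi>) \<in> atlas (hyperelliptic_curve f)"
    then obtain U \<phi> where c: "c = (T ` U, restrict (\<phi> \<circ> inv_into (curve_points f) T) (T ` U))"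
      and U: "is_chart ?X (U, \<phi>)" "locally_translates ?X fst (U, \<phi>)"
      using hyperelliptic_atlas_iff[OF f] by auto
    have "T ` U \<subseteq> ?Y" using TX U(1) by (auto elim!: is_chartE)
    thus "c \<in> atlas (hyperelliptic_curve g)"
      using transport_chart[OF TXY _ U, of fst b] fst restr hyperelliptic_atlas_iff[OF g] by (simp add: c)
  qed
  hence "atlas (hyperelliptic_curve g) =
      {(T ` U, restrict (\<phi> \<circ> inv_into (curve_points f) T) (T ` U)) | U \<phi>. (U, \<phi>) \<in> atlas (hyperelliptic_curve f)}"
    by blast
  thus ?thesis using T sing unfolding translation_isomorphism_def hyperelliptic_curve_def by auto
qed

text \<open>The isomorphism is tested on one chart, the projection \<open>fst\<close> on a sheet
  around \<open>P\<close>. Its transport lies in the atlas of the target and so equals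
  \<open>fst + b\<close> near \<open>T P\<close>; evaluation at \<open>T Q\<close> gives
  \<open>fst Q = fst (T Q) + b\<close>. The constant may still depend on \<open>P\<close>.\<close>

lemma isomorphism_locally_translation:
  assumes f: "f holomorphic_on UNIV" and g: "g holomorphic_on UNIV"
    and iso: "translation_isomorphism (hyperelliptic_curve f) (hyperelliptic_curve g) T"
    and P: "P \<in> curve_points f - curve_Sing f"
  shows "\<exists>W b. openin (top_of_set (curve_points f - curve_Sing f)) W \<and> P \<in> W \<and> (\<forall>Q \<in> W. fst (T Q) = fst Q + b)"
proof -
  let ?X = "curve_points f - curve_Sing f" and ?Y = "curve_points g - curve_Sing g"
  let ?I = "inv_into (curve_points f) T"
  obtain T' where T: "homeomorphism (curve_points f) (curve_points g) T T'"
    and sing: "T ` curve_Sing f = curve_Sing g"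
    and atl: "atlas (hyperelliptic_curve g) =
      {(T ` U, restrict (\<phi> \<circ> ?I) (T ` U)) | U \<phi>. (U, \<phi>) \<in> atlas (hyperelliptic_curve f)}"
    using iso unfolding translation_isomorphism_def by (auto simp: hyperelliptic_curve_def)
  have TXY: "homeomorphism ?X ?Y T T'" using homeomorphism_curve_regular[OF T sing] .
  have inj: "inj_on T (curve_points f)" using T by (auto simp: homeomorphism_def intro: inj_on_inverseI)
  have "continuous_on UNIV f" using f by (rule holomorphic_on_imp_continuous_on)
  hence op: "open {x. f x \<noteq> 0}" by (intro open_Collect_neq) auto
  obtain U V q where U: "openin (top_of_set ?X) U" "P \<in> U" "open V" "V \<subseteq> {x. f x \<noteq> 0}" "homeomorphism U V fst q"
    using curve_projection_local_homeomorphism[OF f P] by blast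
  define \<phi> where "\<phi> = restrict (restrict id V \<circ> fst) U"
  have \<phi>: "\<phi> Q = fst Q" if "Q \<in> U" for Q
    using that U(5) by (auto simp: \<phi>_def homeomorphism_def)
  have "(V, restrict id V) \<in> standard_atlas {x. f x \<noteq> 0}"
    using standard_atlas_iff[OF op] is_chart_id[OF U(3,4)] by blast
  from pullback_chart[OF op this U(1,5)] have "(U, \<phi>) \<in> atlas (hyperelliptic_curve f)"
    unfolding hyperelliptic_atlas_iff[OF f] \<phi>_def by blast
  hence "(T ` U, restrict (\<phi> \<circ> ?I) (T ` U)) \<in> atlas (hyperelliptic_curve g)" using atl by blast
  hence "locally_translates ?Y fst (T ` U, restrict (\<phi> \<circ> ?I) (T ` U))"
    using hyperelliptic_atlas_iff[OF g] by blast
  then obtain W b where W: "openin (top_of_set ?Y) W" "T P \<in> W" "W \<subseteq> T ` U"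
    "\<And>Q. Q \<in> W \<Longrightarrow> restrict (\<phi> \<circ> ?I) (T ` U) Q = fst Q + b"
    by (rule locally_translatesE[of _ _ _ _ "T P"]) (use U(2) in auto)
  have "openin (top_of_set ?X) (T' ` W)"
    using homeomorphism_imp_open_map[OF homeomorphism_symD[OF TXY] W(1)] .
  hence "openin (top_of_set ?X) (U \<inter> T' ` W)" using U(1) by (rule openin_Int[rotated])
  moreover have "P \<in> U \<inter> T' ` W"
    using U(2) W(2) homeomorphism_apply1[OF TXY P] by (metis IntI imageI)
  moreover have "fst (T Q) = fst Q + - b" if "Q \<in> U \<inter> T' ` W" for Q
  proof -
    have "Q \<in> curve_points f" using that openin_imp_subset[OF U(1)] by blast
    moreover have "T Q \<in> W"
      using that homeomorphism_apply2[OF TXY] openin_imp_subset[OF W(1)] by auto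
    ultimately show ?thesis using W(4)[of "T Q"] \<phi>[of Q] that inv_into_f_f[OF inj] by auto
  qed
  ultimately show ?thesis by blast
qed

section \<open>Descent of a fiber-preserving isomorphism to a translation of the plane\<close>

text \<open>A countable set contains no ball. This makes every zero of \<open>f\<close> a limit of
  nonzeros.\<close>

lemma closure_complement_countable:
  fixes S :: "'a::euclidean_space set"
  assumes "countable S"
  shows "closure (- S) = UNIV"
proof -
  have "interior S = {}"
  proof (rule ccontr)
    assume "interior S \<noteq> {}"
    then obtain x e where "e > 0" "ball x e \<subseteq> S" by (auto simp: mem_interior)
    thus False using assms uncountable_ball[of e x] countable_subset by blast
  qed
  thus ?thesis by (simp add: closure_complement)
qed

text \<open>Fiber preservation turns the displacement \<open>fst (T P) - fst P\<close> at regular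
  points into a function of \<open>fst P\<close>. It is locally constant on the plane minus a
  countable set, which is connected; continuity of \<open>T\<close> extends the formula to the
  singular points.\<close>

lemma fiber_preserving_isomorphism_descends:
  assumes f: "f holomorphic_on UNIV" and g: "g holomorphic_on UNIV"
    and countable: "countable {x. f x = 0}"
    and T: "fiber_preserving_isomorphism f g T"
  obtains b where "\<And>P. P \<in> curve_points f \<Longrightarrow> fst (T P) = fst P + b"
proof -
  let ?X = "curve_points f - curve_Sing f"
  define D where "D = {x. f x \<noteq> 0}"
  \<comment> \<open>\<open>\<sigma>\<close> merely selects a point in each fiber. Jumps of
    \<open>csqrt\<close> across its branch cut are harmless, since \<open>fst (T P)\<close> is the
    same for all points of a regular fiber.\<close>
  define \<sigma> where "\<sigma> x = (x, csqrt (f x))" for x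
  have iso: "translation_isomorphism (hyperelliptic_curve f) (hyperelliptic_curve g) T"
    using T unfolding fiber_preserving_isomorphism_def by (rule conjunct1)
  have fib: "fst (T P) = fst (T Q)"
    if "fst P \<in> D" "P \<in> curve_points f" "Q \<in> curve_points f" "fst P = fst Q" for P Q
    using T that unfolding fiber_preserving_isomorphism_def D_def mem_Collect_eq by metis
  have \<sigma>: "\<sigma> x \<in> curve_points f" "fst (\<sigma> x) = x" for x by (auto simp: \<sigma>_def curve_points_def)
  have X: "P \<in> ?X \<longleftrightarrow> P \<in> curve_points f \<and> fst P \<in> D" for P
    by (cases P) (auto simp: curve_points_def curve_Sing_def D_def)
  have DC: "D = - {x. f x = 0}" by (auto simp: D_def)
  have "(\<lambda>x. fst (T (\<sigma> x)) - x) constant_on D"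
  proof (rule locally_constant_imp_constant)
    show "connected D" unfolding DC
      by (intro path_connected_imp_connected path_connected_complement_countable countable) simp
    fix x assume x: "x \<in> D"
    have \<sigma>x: "\<sigma> x \<in> ?X" unfolding X using \<sigma> x by simp
    obtain W b where W: "openin (top_of_set ?X) W" "\<sigma> x \<in> W" "\<And>Q. Q \<in> W \<Longrightarrow> fst (T Q) = fst Q + b"
      using isomorphism_locally_translation[OF f g iso \<sigma>x] by blast
    obtain U V q where U: "openin (top_of_set ?X) U" "\<sigma> x \<in> U" "open V" "homeomorphism U V fst q"
      using curve_projection_local_homeomorphism[OF f \<sigma>x] by blast
    \<comment> \<open>The projection is open on the sheet \<open>U\<close>, so it maps
      \<open>W \<inter> U\<close> onto a neighbourhood of \<open>x\<close>.\<close>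
    have "openin (top_of_set U) (W \<inter> U)"
      using openin_subset_trans[OF openin_Int[OF W(1) U(1)]] openin_imp_subset[OF U(1)] by blast
    hence "open (fst ` (W \<inter> U))" using homeomorphism_imp_open_map[OF U(4)] U(3) openin_open_eq by blast
    hence "openin (top_of_set D) (D \<inter> fst ` (W \<inter> U))" by (rule openin_open_Int)
    moreover have "x \<in> fst ` (W \<inter> U)" using W(2) U(2) \<sigma>(2) by (metis IntI imageI)
    moreover have "fst (T (\<sigma> y)) - y = b" if "y \<in> fst ` (W \<inter> U)" for y
    proof -
      from that obtain Q where Q: "Q \<in> W" "y = fst Q" by blast
      hence "Q \<in> ?X" using openin_imp_subset[OF W(1)] by blast
      \<comment> \<open>The point \<open>\<sigma> y\<close> may lie on the other sheet, outside
        \<open>W\<close>; fiber preservation replaces it by \<open>Q\<close>.\<close>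
      hence "fst (T (\<sigma> y)) = fst (T Q)" using X \<sigma> Q by (intro fib) auto
      thus ?thesis using W(3) Q by simp
    qed
    ultimately show "\<exists>S. openin (top_of_set D) S \<and> x \<in> S \<and> (\<forall>y\<in>S. fst (T (\<sigma> y)) - y = fst (T (\<sigma> x)) - x)"
      using x by (intro exI[of _ "D \<inter> fst ` (W \<inter> U)"]) auto
  qed
  then obtain b where b: "\<And>x. x \<in> D \<Longrightarrow> fst (T (\<sigma> x)) - x = b" unfolding constant_on_def by blast
  have "fst (T P) = fst P + b" if P: "P \<in> curve_points f" for P
  proof (cases "fst P \<in> D")
    case True
    hence "fst (T P) = fst (T (\<sigma> (fst P)))" using True P \<sigma> by (intro fib) auto
    thus ?thesis using b[OF True] by (simp add: algebra_simps)
  next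
    case False
    define a where "a = fst P"
    have fa: "f a = 0" and Pa: "P = \<sigma> a"
      using False P by (auto simp: a_def D_def \<sigma>_def curve_points_def)
    have nb: "at a within D \<noteq> bot"
      using closure_complement_countable[OF countable] fa by (auto simp: at_within_eq_bot_iff DC)
    have "continuous_on UNIV f" using f by (rule holomorphic_on_imp_continuous_on)
    hence "(f \<longlongrightarrow> f a) (at a)" by (simp add: continuous_on_def)
    hence "(f \<longlongrightarrow> f a) (at a within D)" by (rule tendsto_within_subset) simp
    hence "(f \<longlongrightarrow> 0) (at a within D)" by (simp only: fa)
    hence "((\<lambda>x. sqrt (norm (f x))) \<longlongrightarrow> sqrt (norm (0::complex))) (at a within D)"
      by (intro tendsto_intros)
    \<comment> \<open>This modulus identity shows that \<open>csqrt (f x)\<close> tends to 0 at a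
      zero of \<open>f\<close>, so \<open>\<sigma>\<close> is continuous there.\<close>
    moreover have "norm (csqrt w) = sqrt (norm w)" for w
      by (rule real_sqrt_unique[symmetric]) (simp_all flip: norm_power)
    ultimately have "((\<lambda>x. csqrt (f x)) \<longlongrightarrow> 0) (at a within D)"
      by (subst tendsto_norm_zero_iff[symmetric]) simp
    hence "(\<sigma> \<longlongrightarrow> \<sigma> a) (at a within D)"
      unfolding \<sigma>_def using fa by (auto intro!: tendsto_intros)
    moreover have "continuous_on (curve_points f) T"
      using iso unfolding translation_isomorphism_def
      by (auto simp: hyperelliptic_curve_def intro: homeomorphism_cont1)
    ultimately have "((\<lambda>x. T (\<sigma> x)) \<longlongrightarrow> T (\<sigma> a)) (at a within D)"
      using \<sigma>(1) by (intro continuous_on_tendsto_compose[of "curve_points f" T]) simp_all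
    hence "((\<lambda>x. fst (T (\<sigma> x)) - x) \<longlongrightarrow> fst (T (\<sigma> a)) - a) (at a within D)"
      by (intro tendsto_intros)
    moreover have "\<forall>\<^sub>F x in at a within D. fst (T (\<sigma> x)) - x = b"
      using b by (auto simp: eventually_at_filter)
    ultimately have "((\<lambda>x. b) \<longlongrightarrow> fst (T (\<sigma> a)) - a) (at a within D)"
      by (rule Lim_transform_eventually)
    hence "fst (T (\<sigma> a)) - a = b" using nb tendsto_unique tendsto_const by blast
    thus ?thesis using \<sigma>(2)[of a] by (simp add: Pa algebra_simps)
  qed
  thus ?thesis using that by blast
qed

section \<open>Lifting a translation of the plane to the curves\<close>

lemma translated_zeros_imp_fiber_preserving_isomorphism:
  assumes f: "f holomorphic_on UNIV" and g: "g holomorphic_on UNIV"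
    and f': "\<And>x. f x = 0 \<Longrightarrow> deriv f x \<noteq> 0" and g': "\<And>x. g x = 0 \<Longrightarrow> deriv g x \<noteq> 0"
    and zeros: "(\<lambda>x. x + b) ` {x. f x = 0} = {x. g x = 0}"
  shows "\<exists>T. fiber_preserving_isomorphism f g T"
proof -
  \<comment> \<open>Translating the argument of \<open>g\<close> moves its zeros back onto those of
    \<open>f\<close>, so the two functions can be compared at the same point.\<close>
  define h where "h x = g (x + b)" for x
  have gd: "(g has_field_derivative deriv g x) (at x)" for x using g by (auto intro: holomorphic_derivI)
  have "(h has_field_derivative deriv g (x + b)) (at x)" for x
    unfolding h_def using gd[of "x + b"] by (simp add: DERIV_shift)
  hence h': "deriv h x = deriv g (x + b)" for x by (rule DERIV_imp_deriv)
  have h: "h holomorphic_on UNIV"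
    unfolding h_def using holomorphic_on_compose_gen[of "\<lambda>x. x + b" UNIV g UNIV] g
    by (simp add: o_def holomorphic_on_add)
  have fh: "f x = 0 \<longleftrightarrow> h x = 0" for x
  proof -
    have "g (x + b) = 0 \<longleftrightarrow> x + b \<in> (\<lambda>x. x + b) ` {x. f x = 0}" using zeros by blast
    thus ?thesis by (auto simp: h_def)
  qed
  obtain s where s: "s holomorphic_on UNIV" "\<And>x. s x \<noteq> 0" "\<And>x. h x = (s x)\<^sup>2 * f x"
    using same_simple_zeros_eq_square_mult[OF f h fh f'] g' h' h_def by metis
  have cs: "continuous_on A (\<lambda>P. s (k P))" if "continuous_on A k" for A k
    using continuous_on_compose2[OF holomorphic_on_imp_continuous_on[OF s(1)] that] by simp
  \<comment> \<open>Scaling the second coordinate by \<open>s\<close> is forced up to sign: a point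
    over \<open>x + b\<close> must satisfy the equation with right side
    \<open>(s x)\<^sup>2 * f x\<close>.\<close>
  define T where "T P = (fst P + b, s (fst P) * snd P)" for P
  define T' where "T' P = (fst P - b, snd P / s (fst P - b))" for P
  have TT': "T (T' P) = P" "T' (T P) = P" for P using s(2) by (auto simp: T_def T'_def)
  have gs: "g (x + b) = (s x)\<^sup>2 * f x" for x using s(3) by (simp add: h_def)
  have T: "T P \<in> curve_points g" if "P \<in> curve_points f" for P
    using that by (auto simp: T_def curve_points_def gs power_mult_distrib)
  have T': "T' P \<in> curve_points f" if "P \<in> curve_points g" for P
    using that gs[of "fst P - b"] s(2) by (auto simp: T'_def curve_points_def power_divide)
  have "homeomorphism (curve_points f) (curve_points g) T T'"
  proof (rule homeomorphismI)
    show "continuous_on (curve_points f) T" unfolding T_def by (intro continuous_intros cs)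
    show "continuous_on (curve_points g) T'" unfolding T'_def
      by (intro continuous_intros cs) (use s(2) in auto)
  qed (use T T' TT' in auto)
  moreover have "T ` curve_Sing f = curve_Sing g"
  proof -
    have "T ` curve_Sing f = (\<lambda>x. (x, 0)) ` (\<lambda>x. x + b) ` {x. f x = 0}"
      by (force simp: curve_Sing_def T_def image_iff)
    also have "\<dots> = curve_Sing g" unfolding zeros by (auto simp: curve_Sing_def)
    finally show ?thesis .
  qed
  ultimately have "translation_isomorphism (hyperelliptic_curve f) (hyperelliptic_curve g) T"
    using f g by (intro translation_isomorphism_hyperelliptic_curve) (auto simp: T_def)
  thus ?thesis unfolding fiber_preserving_isomorphism_def by (intro exI[of _ T]) (auto simp: T_def)
qed

theorem theorem1p7:
  fixes z z' :: "nat \<Rightarrow> complex" and f g :: "complex \<Rightarrow> complex"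
  assumes "inj z" and "inj z'"
    and "filterlim (\<lambda>k. norm (z k)) at_top sequentially"
    and "filterlim (\<lambda>k. norm (z' k)) at_top sequentially"
    and "weierstrass_map z f" and "weierstrass_map z' g"
  shows "(\<exists>T. fiber_preserving_isomorphism f g T) \<longleftrightarrow>
         (\<exists>T. translation_isomorphism plane plane T \<and> T ` {x. f x = 0} = {x. g x = 0})"
proof -
  have f: "f holomorphic_on UNIV" and g: "g holomorphic_on UNIV"
    using assms(5,6) by (auto intro: weierstrass_map_holomorphic)
  \<comment> \<open>Isomorphisms of the plane are exactly the translations, so only the translation
    vector remains to be found.\<close>
  have "(\<exists>T. translation_isomorphism plane plane T \<and> T ` {x. f x = 0} = {x. g x = 0}) \<longleftrightarrow>
      (\<exists>b. (\<lambda>x. x + b) ` {x. f x = 0} = {x. g x = 0})" (is "?P \<longleftrightarrow> _")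
  proof
    assume ?P
    then obtain T where T: "translation_isomorphism plane plane T" "T ` {x. f x = 0} = {x. g x = 0}"
      by (elim exE conjE)
    from T(1) obtain b where "T = (\<lambda>x. x + b)" unfolding plane_isomorphism_iff by auto
    thus "\<exists>b. (\<lambda>x. x + b) ` {x. f x = 0} = {x. g x = 0}" using T(2) by (intro exI[of _ b]) simp
  next
    assume "\<exists>b. (\<lambda>x. x + b) ` {x. f x = 0} = {x. g x = 0}"
    then obtain b where "(\<lambda>x. x + b) ` {x. f x = 0} = {x. g x = 0}" ..
    thus ?P unfolding plane_isomorphism_iff by (intro exI[of _ "\<lambda>x. x + b"]) auto
  qed
  also have "\<dots> \<longleftrightarrow> (\<exists>T. fiber_preserving_isomorphism f g T)"
  proof
    assume "\<exists>T. fiber_preserving_isomorphism f g T"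
    then obtain T where T: "fiber_preserving_isomorphism f g T" by blast
    have "countable {x. f x = 0}" using weierstrass_map_zeros[OF assms(5)] by simp
    then obtain b where b: "\<And>P. P \<in> curve_points f \<Longrightarrow> fst (T P) = fst P + b"
      using fiber_preserving_isomorphism_descends[OF f g _ T] by blast
    have "T ` curve_Sing f = curve_Sing g"
      using T by (simp add: fiber_preserving_isomorphism_def translation_isomorphism_def hyperelliptic_curve_def)
    \<comment> \<open>Singular points project bijectively onto zeros, so the equality of singular
      sets becomes one of zero sets after taking first coordinates.\<close>
    moreover have "fst ` T ` curve_Sing f = (\<lambda>x. x + b) ` fst ` curve_Sing f"
      unfolding image_image using b by (intro image_cong) (auto simp: curve_Sing_def curve_points_def)
    moreover have "fst ` curve_Sing k = {x. k x = 0}" for k by (force simp: curve_Sing_def)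
    ultimately have "(\<lambda>x. x + b) ` {x. f x = 0} = {x. g x = 0}" by metis
    thus "\<exists>b. (\<lambda>x. x + b) ` {x. f x = 0} = {x. g x = 0}" ..
  next
    assume "\<exists>b. (\<lambda>x. x + b) ` {x. f x = 0} = {x. g x = 0}"
    then obtain b where "(\<lambda>x. x + b) ` {x. f x = 0} = {x. g x = 0}" ..
    thus "\<exists>T. fiber_preserving_isomorphism f g T"
      by (intro translated_zeros_imp_fiber_preserving_isomorphism[OF f g
            weierstrass_map_deriv_nonzero[OF assms(5,1)] weierstrass_map_deriv_nonzero[OF assms(6,2)]])
  qed
  finally show ?thesis by (rule sym)
qed

end
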